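(* Let $n\ge 0$ be an integer and $\boldsymbol{b},\boldsymbol{c}\in\mathbb{R}^{2^n}$. For $\boldsymbol{x}=(x_1,\dots,x_{2^n})^\top\in\mathbb{Z}^{2^n}$, let $\boldsymbol{\beta}_{L,a}=\boldsymbol{\beta}_{L,a}(\boldsymbol{x})$ and $\boldsymbol{\gamma}_{L,a}=\boldsymbol{\gamma}_{L,a}(\boldsymbol{x})$ be the vectors defined in the context from $\boldsymbol{b}$, $\boldsymbol{c}$ and $\boldsymbol{x}$. Then, for every $\boldsymbol{x}\in\mathbb{Z}^{2^n}$, the inequality $\boldsymbol{b}\le A_n\boldsymbol{x}\le\boldsymbol{c}$ is equivalent to the $2^n$ simultaneous inequalities $$\boldsymbol{\beta}_{0,i}\le x_i\le\boldsymbol{\gamma}_{0,i}\qquad\text{for } 1\le i\le 2^n.$$ Moreover, $\boldsymbol{\beta}_{0,1}$ and $\boldsymbol{\gamma}_{0,1}$ depend only on $\boldsymbol{b},\boldsymbol{c}$ (not on $\boldsymbol{x}$), and for $2\le i\le 2^n$ the numbers $\boldsymbol{\beta}_{0,i}$ and $\boldsymbol{\gamma}_{0,i}$ are determined by $\boldsymbol{b},\boldsymbol{c}$ and $x_1,\dots,x_{i-1}$; that is, if $\boldsymbol{x},\boldsymbol{x}'\in\mathbb{Z}^{2^n}$ satisfy $x_j=x'_j$ for all $1\le j\le i-1$, then $\boldsymbol{\beta}_{0,i}(\boldsymbol{x})=\boldsymbol{\beta}_{0,i}(\boldsymbol{x}')$ and $\boldsymbol{\gamma}_{0,i}(\bo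ldsymbol{x})=\boldsymbol{\gamma}_{0,i}(\boldsymbol{x}')$.
   Context: For vectors $\boldsymbol{u},\boldsymbol{v}$ of the same dimension, $\boldsymbol{u}\le\boldsymbol{v}$ means componentwise inequality, and $\max(\boldsymbol{u},\boldsymbol{v})$, $\min(\boldsymbol{u},\boldsymbol{v})$ are taken componentwise. $(\boldsymbol{x}_1;\boldsymbol{x}_2)$ denotes vertical concatenation of column vectors. Define integers $\sigma(m,k)$, $m\ge 0$, $1\le k\le 2^m$, recursively by $\sigma(0,1)=1$ and, with $d=2^m$, $\sigma(m+1,k)=\sigma(m,k)$ if $1\le k\le d$, $\sigma(m+1,k)=2d+1-\sigma(m,k-d)$ if $d+1\le k\le 2d$. Define $\xi_{m,k}=2\cos\left(\frac{\pi(2\sigma(m,k)-1)}{2\cdot 2^m}\right)$ for $1\le k\le 2^m$. Let $D_m=\operatorname{diag}(\xi_{m+1,1},\dots,\xi_{m+1,2^m})\in\mathbb{R}^{2^m\times 2^m}$. Define $A_m\in\mathbb{R}^{2^m\times 2^m}$ recursively by $A_0=1$ and $$A_{m+1}=\begin{pmatrix}A_m & D_mA_m\\ A_m & -D_mA_m\end{pmatrix}.$$ For $\boldsymbol{a}_1\in\mathbb{R}^{2^m}$ and $\boldsymbol{u}=(\boldsymbol{u}_1;\boldsymbol{u}_2),\ \boldsymbol{v}=(\boldsymbol{v}_1;\boldsymbol{v}_2)\in\mathbb{R}^{2^{m+1}}$ with $\boldsymbol{u}_i,\boldsymbol{v}_i\in\mathbb{R}^{2^m}$, define $\rho_m(\boldsymbol{u})=(\boldsymbol{u}_1+\boldsymbol{u}_2)/2$,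 $\phi_m(\boldsymbol{a}_1,\boldsymbol{u},\boldsymbol{v})=D_m^{-1}\max(\boldsymbol{u}_1-\boldsymbol{a}_1,\,-\boldsymbol{v}_2+\boldsymbol{a}_1)$, $\psi_m(\boldsymbol{a}_1,\boldsymbol{u},\boldsymbol{v})=D_m^{-1}\min(\boldsymbol{v}_1-\boldsymbol{a}_1,\,-\boldsymbol{u}_2+\boldsymbol{a}_1)$, all in $\mathbb{R}^{2^m}$. Fix $n$ and $\boldsymbol{b},\boldsymbol{c}\in\mathbb{R}^{2^n}$. For $\boldsymbol{x}=(x_1,\dots,x_{2^n})^\top\in\mathbb{Z}^{2^n}$, $0\le L\le n$ and $1\le a\le 2^{n-L}$, put $\boldsymbol{x}_{L,a}=(x_{(a-1)2^L+1},\dots,x_{a2^L})^\top\in\mathbb{Z}^{2^L}$ and $\boldsymbol{\alpha}_{L,a}=A_L\boldsymbol{x}_{L,a}\in\mathbb{R}^{2^L}$. Define $\boldsymbol{\beta}_{L,a},\boldsymbol{\gamma}_{L,a}\in\mathbb{R}^{2^L}$ by downward recursion on $L$: $\boldsymbol{\beta}_{n,1}=\boldsymbol{b}$, $\boldsymbol{\gamma}_{n,1}=\boldsymbol{c}$, and for $1\le L\le n$, $1\le a\le 2^{n-L}$, $$\boldsymbol{\beta}_{L-1,2a-1}=\rho_{L-1}(\boldsymbol{\beta}_{L,a}),\qquad \boldsymbol{\gamma}_{L-1,2a-1}=\rho_{L-1}(\boldsymbol{\gamma}_{L,a}),$$ $$\boldsymbol{\beta}_{L-1,2a}=\phi_{L-1}(\boldsymbol{\alpha}_{L-1,2a-1},\boldsymbol{\beta}_{L,a},\boldsymbol{\gamma}_{L,a}),\qquad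 \boldsymbol{\gamma}_{L-1,2a}=\psi_{L-1}(\boldsymbol{\alpha}_{L-1,2a-1},\boldsymbol{\beta}_{L,a},\boldsymbol{\gamma}_{L,a}).$$ *)

theory Defs
  imports Complex_Main "Jordan_Normal_Form.Gauss_Jordan_Elimination"
begin

text \<open>The arguments \<open>k\<close> of \<open>sigma\<close> and \<open>xi\<close>, the block numbers \<open>a\<close> below and the coordinate
  numbers \<open>i\<close> in \<open>x\<^sub>i\<close> count from 1. The entries of \<^typ>\<open>'a vec\<close> and \<^typ>\<open>'a mat\<close> count from 0,
  so that \<open>x\<^sub>i\<close> is \<open>x $ (i - 1)\<close>.\<close>

fun sigma :: "nat \<Rightarrow> nat \<Rightarrow> int" where
  "sigma 0 k = 1"
| "sigma (Suc m) k =
    (if k \<le> 2 ^ m then sigma m k else 2 * 2 ^ m + 1 - sigma m (k - 2 ^ m))"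

definition xi :: "nat \<Rightarrow> nat \<Rightarrow> real" where
  "xi m k = 2 * cos (pi * (2 * real_of_int (sigma m k) - 1) / (2 * 2 ^ m))"

definition D_mat :: "nat \<Rightarrow> real mat" where
  "D_mat m = mat_diag (2 ^ m) (\<lambda>i. xi (m + 1) (i + 1))"

fun A_mat :: "nat \<Rightarrow> real mat" where
  "A_mat 0 = 1\<^sub>m 1"
| "A_mat (Suc m) =
    four_block_mat (A_mat m) (D_mat m * A_mat m) (A_mat m) (- D_mat m * A_mat m)"

text \<open>\<open>mat_inverse\<close> returns \<open>None\<close> on singular matrices; \<open>D_inv\<close> below shows that this does not
  happen here.\<close>

definition D_inv :: "nat \<Rightarrow> real mat" where
  "D_inv m = the (mat_inverse (D_mat m))"

definition max_vec :: "real vec \<Rightarrow> real vec \<Rightarrow> real vec" where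
  "max_vec u v = vec (dim_vec u) (\<lambda>i. max (u $ i) (v $ i))"

definition min_vec :: "real vec \<Rightarrow> real vec \<Rightarrow> real vec" where
  "min_vec u v = vec (dim_vec u) (\<lambda>i. min (u $ i) (v $ i))"

definition rho :: "nat \<Rightarrow> real vec \<Rightarrow> real vec" where
  "rho m u = (1 / 2) \<cdot>\<^sub>v (vec_first u (2 ^ m) + vec_last u (2 ^ m))"

definition phi :: "nat \<Rightarrow> real vec \<Rightarrow> real vec \<Rightarrow> real vec \<Rightarrow> real vec" where
  "phi m a1 u v =
    D_inv m *\<^sub>v max_vec (vec_first u (2 ^ m) - a1) (- vec_last v (2 ^ m) + a1)"

definition psi :: "nat \<Rightarrow> real vec \<Rightarrow> real vec \<Rightarrow> real vec \<Rightarrow> real vec" where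
  "psi m a1 u v =
    D_inv m *\<^sub>v min_vec (vec_first v (2 ^ m) - a1) (- vec_last u (2 ^ m) + a1)"

definition block :: "int vec \<Rightarrow> nat \<Rightarrow> nat \<Rightarrow> int vec" where
  "block x L a = vec (2 ^ L) (\<lambda>i. x $ ((a - 1) * 2 ^ L + i))"

definition alpha :: "int vec \<Rightarrow> nat \<Rightarrow> nat \<Rightarrow> real vec" where
  "alpha x L a = A_mat L *\<^sub>v map_vec real_of_int (block x L a)"

text \<open>The recursion runs downwards from level \<open>n\<close>. The values are meaningful for \<open>L \<le> n\<close> and
  \<open>1 \<le> a \<le> 2 ^ (n - L)\<close>. Block \<open>a\<close> at level \<open>L\<close> is the first (\<open>a\<close> odd) or the second
  (\<open>a\<close> even) half of block \<open>(a + 1) div 2\<close> at level \<open>L + 1\<close>.\<close>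

function (sequential)
  beta :: "nat \<Rightarrow> real vec \<Rightarrow> real vec \<Rightarrow> int vec \<Rightarrow> nat \<Rightarrow> nat \<Rightarrow> real vec" and
  gamma :: "nat \<Rightarrow> real vec \<Rightarrow> real vec \<Rightarrow> int vec \<Rightarrow> nat \<Rightarrow> nat \<Rightarrow> real vec"
where
  "beta n b c x L a =
    (if L \<ge> n then b
     else let a' = (a + 1) div 2 in
       if odd a then rho L (beta n b c x (L + 1) a')
       else phi L (alpha x L (a - 1)) (beta n b c x (L + 1) a') (gamma n b c x (L + 1) a'))"
| "gamma n b c x L a =
    (if L \<ge> n then c
     else let a' = (a + 1) div 2 in
       if odd a then rho L (gamma n b c x (L + 1) a')
       else psi L (alpha x L (a - 1)) (beta n b c x (L + 1) a') (gamma n b c x (L + 1) a'))"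
  by pat_completeness auto
termination
  by (relation "measure (case_sum (\<lambda>(n, b, c, x, L, a). n - L) (\<lambda>(n, b, c, x, L, a). n - L))") auto

declare beta.simps [simp del] gamma.simps [simp del]

lemma beta_gamma_top: "beta n b c x n 1 = b" "gamma n b c x n 1 = c"
  by (simp_all add: beta.simps gamma.simps)

lemma beta_gamma_step:
  assumes "1 \<le> L" "L \<le> n" "1 \<le> a"
  shows "beta n b c x (L - 1) (2 * a - 1) = rho (L - 1) (beta n b c x L a)"
    and "gamma n b c x (L - 1) (2 * a - 1) = rho (L - 1) (gamma n b c x L a)"
    and "beta n b c x (L - 1) (2 * a) =
      phi (L - 1) (alpha x (L - 1) (2 * a - 1)) (beta n b c x L a) (gamma n b c x L a)"
    and "gamma n b c x (L - 1) (2 * a) =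
      psi (L - 1) (alpha x (L - 1) (2 * a - 1)) (beta n b c x L a) (gamma n b c x L a)"
proof -
  obtain l k where "L = Suc l" "a = Suc k"
    using assms by (metis Suc_le_D One_nat_def)
  with assms show "beta n b c x (L - 1) (2 * a - 1) = rho (L - 1) (beta n b c x L a)"
    and "gamma n b c x (L - 1) (2 * a - 1) = rho (L - 1) (gamma n b c x L a)"
    and "beta n b c x (L - 1) (2 * a) =
      phi (L - 1) (alpha x (L - 1) (2 * a - 1)) (beta n b c x L a) (gamma n b c x L a)"
    and "gamma n b c x (L - 1) (2 * a) =
      psi (L - 1) (alpha x (L - 1) (2 * a - 1)) (beta n b c x L a) (gamma n b c x L a)"
    by (simp_all add: beta.simps[of n b c x l] gamma.simps[of n b c x l])
qed

lemma sigma_bounds: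
  assumes "1 \<le> k" "k \<le> 2 ^ m"
  shows "1 \<le> sigma m k \<and> sigma m k \<le> 2 ^ m"
  using assms
proof (induction m arbitrary: k)
  case (Suc m)
  show ?case
  proof (cases "k \<le> 2 ^ m")
    case True
    then have "1 \<le> sigma m k \<and> sigma m k \<le> 2 ^ m"
      using Suc.IH[of k] Suc.prems by auto
    with True show ?thesis by simp
  next
    case False
    then have "1 \<le> sigma m (k - 2 ^ m) \<and> sigma m (k - 2 ^ m) \<le> 2 ^ m"
      using Suc.IH[of "k - 2 ^ m"] Suc.prems by auto
    with False show ?thesis by simp
  qed
qed simp

lemma xi_pos:
  assumes "1 \<le> k" "k \<le> 2 ^ m"
  shows "0 < xi (m + 1) k"
proof -
  define s where "s = real_of_int (sigma m k)"
  have s: "1 \<le> s" "s \<le> 2 ^ m"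
    using sigma_bounds[OF assms] unfolding s_def by (simp, metis of_int_le_iff of_int_numeral of_int_power)
  have eq: "pi * (2 * s - 1) / (2 * 2 ^ (m + 1)) = (pi / 2) * ((2 * s - 1) / (2 * 2 ^ m))"
    by (simp add: field_simps)
  have "0 < (2 * s - 1) / (2 * 2 ^ m)" "(2 * s - 1) / (2 * 2 ^ m) < 1"
    using s by (simp_all add: field_simps)
  then have "0 < (pi / 2) * ((2 * s - 1) / (2 * 2 ^ m))"
    "(pi / 2) * ((2 * s - 1) / (2 * 2 ^ m)) < (pi / 2) * 1"
    by (intro mult_pos_pos mult_strict_left_mono; simp)+
  then show ?thesis
    using assms eq cos_gt_zero[of "pi * (2 * s - 1) / (2 * 2 ^ (m + 1))"]
    unfolding xi_def s_def by simp
qed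

lemma D_inv:
  "D_inv m \<in> carrier_mat (2 ^ m) (2 ^ m)"
  "D_mat m * D_inv m = 1\<^sub>m (2 ^ m)"
  "D_inv m * D_mat m = 1\<^sub>m (2 ^ m)"
proof -
  let ?x = "\<lambda>i. xi (m + 1) (i + 1)"
  let ?E = "mat_diag (2 ^ m) (\<lambda>i. inverse (?x i))"
  have ne: "?x i \<noteq> 0" if "i < 2 ^ m" for i
    using xi_pos[of "i + 1" m] that by simp
  have "D_mat m * ?E = 1\<^sub>m (2 ^ m)" "?E * D_mat m = 1\<^sub>m (2 ^ m)"
    unfolding D_mat_def mat_diag_diag by (intro eq_matI; use ne in \<open>auto simp: mat_diag_def\<close>)+
  moreover have D: "D_mat m \<in> carrier_mat (2 ^ m) (2 ^ m)"
    by (simp add: D_mat_def)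
  ultimately have "D_mat m \<in> Units (ring_mat TYPE(real) (2 ^ m) ())"
    unfolding Units_def ring_mat_def by (auto intro!: bexI[of _ ?E])
  then obtain B where "mat_inverse (D_mat m) = Some B"
    using mat_inverse(1)[OF D] by fastforce
  with mat_inverse(2)[OF D this]
  show "D_inv m \<in> carrier_mat (2 ^ m) (2 ^ m)" "D_mat m * D_inv m = 1\<^sub>m (2 ^ m)"
    "D_inv m * D_mat m = 1\<^sub>m (2 ^ m)"
    unfolding D_inv_def by auto
qed

end

theory Submission
  imports Defs
begin

text \<open>One level of the recursion is an equivalence of inequalities. Split a vector \<open>(x\<^sub>1; x\<^sub>2)\<close>
  of length \<open>2\<^bsup>m+1\<^esup>\<close> into halves and put \<open>p = A\<^sub>m x\<^sub>1\<close>, \<open>q = A\<^sub>m x\<^sub>2\<close>. By the block form of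
  \<open>A\<^sub>m\<^sub>+\<^sub>1\<close>, the vector \<open>A\<^sub>m\<^sub>+\<^sub>1 (x\<^sub>1; x\<^sub>2)\<close> is \<open>(p + D\<^sub>m q; p - D\<^sub>m q)\<close>. Bounds \<open>u\<close>, \<open>v\<close> on it are four
  inequalities per coordinate. Solved for \<open>D\<^sub>m q\<close>, they say that \<open>q\<close> lies between
  \<open>\<phi>\<^sub>m(p, u, v)\<close> and \<open>\<psi>\<^sub>m(p, u, v)\<close>, because the diagonal entries of \<open>D\<^sub>m\<close> are positive; and
  adding the bounds on the two halves eliminates \<open>q\<close> and gives \<open>\<rho>\<^sub>m(u) \<le> p \<le> \<rho>\<^sub>m(v)\<close>.
  This is \<open>append_bounds_iff_halved_bounds\<close>.

  Applying it to every block of a level replaces the bounds on \<open>\<alpha>\<^sub>L\<^sub>+\<^sub>1\<close> by those on \<open>\<alpha>\<^sub>L\<close>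
  (\<open>bounds_iff_block_bounds\<close>). At level \<open>n\<close> the only block is \<open>A\<^sub>n x\<close>, bounded by \<open>b\<close> and \<open>c\<close>;
  at level 0 the blocks are the coordinates of \<open>x\<close>.

  The bounds on a first half are computed from the bounds on the parent block alone; those on a
  second half use in addition the entries of the first half, which precede it. Hence the bounds
  on any block depend only on the entries of \<open>x\<close> before that block (\<open>beta_gamma_cong\<close>).\<close>

lemma D_mat_carrier: "D_mat m \<in> carrier_mat (2 ^ m) (2 ^ m)"
  by (simp add: D_mat_def)

lemma A_mat_carrier: "A_mat m \<in> carrier_mat (2 ^ m) (2 ^ m)"
proof (induction m)
  case (Suc m)
  then have "D_mat m * A_mat m \<in> carrier_mat (2 ^ m) (2 ^ m)"
    "- D_mat m * A_mat m \<in> carrier_mat (2 ^ m) (2 ^ m)"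
    using D_mat_carrier[of m] by (simp_all add: mult_carrier_mat[of _ "2 ^ m" "2 ^ m"])
  with Suc show ?case
    by (simp add: mult_2)
qed simp

lemma D_mat_mult_vec_index:
  assumes "w \<in> carrier_vec (2 ^ m)" "i < 2 ^ m"
  shows "(D_mat m *\<^sub>v w) $ i = xi (m + 1) (i + 1) * w $ i"
proof -
  have "(D_mat m *\<^sub>v w) $ i
    = (\<Sum>j = 0..<2 ^ m. (if i = j then xi (m + 1) (j + 1) else 0) * w $ j)"
    using assms by (simp add: D_mat_def mat_diag_def scalar_prod_def cong: if_cong)
  also have "\<dots> = (\<Sum>j = 0..<2 ^ m. if i = j then xi (m + 1) (j + 1) * w $ j else 0)"
    by (rule sum.cong) auto
  also have "\<dots> = xi (m + 1) (i + 1) * w $ i"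
    using assms(2) by simp
  finally show ?thesis .
qed

lemma D_inv_mult_vec_index:
  assumes "w \<in> carrier_vec (2 ^ m)" "i < 2 ^ m"
  shows "(D_inv m *\<^sub>v w) $ i = w $ i / xi (m + 1) (i + 1)"
proof -
  have "D_mat m *\<^sub>v (D_inv m *\<^sub>v w) = w"
    using assoc_mult_mat_vec[OF D_mat_carrier D_inv(1) assms(1)] D_inv(2)[of m] assms(1) by simp
  moreover have "D_inv m *\<^sub>v w \<in> carrier_vec (2 ^ m)"
    by (rule mult_mat_vec_carrier[OF D_inv(1) assms(1)])
  ultimately have "xi (m + 1) (i + 1) * (D_inv m *\<^sub>v w) $ i = w $ i"
    using D_mat_mult_vec_index[of "D_inv m *\<^sub>v w" m i] assms(2) by simp
  then show ?thesis
    using xi_pos[of "i + 1" m] assms(2) by (simp add: field_simps)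
qed

lemma A_mat_Suc_mult_append:
  assumes v: "v \<in> carrier_vec (2 ^ m)" and w: "w \<in> carrier_vec (2 ^ m)"
  shows "A_mat (Suc m) *\<^sub>v (v @\<^sub>v w) =
    (A_mat m *\<^sub>v v + D_mat m *\<^sub>v (A_mat m *\<^sub>v w)) @\<^sub>v
    (A_mat m *\<^sub>v v - D_mat m *\<^sub>v (A_mat m *\<^sub>v w))"
proof -
  note [simp] = D_mat_carrier A_mat_carrier
  have D: "D_mat m * A_mat m \<in> carrier_mat (2 ^ m) (2 ^ m)"
    by (rule mult_carrier_mat[OF D_mat_carrier A_mat_carrier])
  have "dim_col (D_mat m) = dim_row (A_mat m)"
    using carrier_matD[OF D_mat_carrier[of m]] carrier_matD[OF A_mat_carrier[of m]] by simp
  then have neg_eq: "- D_mat m * A_mat m = - (D_mat m * A_mat m)"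
    by (rule uminus_mult_left_mat)
  have neg: "(- D_mat m * A_mat m) *\<^sub>v w = - (D_mat m *\<^sub>v (A_mat m *\<^sub>v w))"
    unfolding neg_eq assoc_mult_mat_vec[OF D_mat_carrier A_mat_carrier w, symmetric]
    using D w by (intro uminus_mult_mat_vec) auto
  have Dw: "D_mat m *\<^sub>v (A_mat m *\<^sub>v w) \<in> carrier_vec (2 ^ m)"
    by (rule mult_mat_vec_carrier[OF D_mat_carrier mult_mat_vec_carrier[OF A_mat_carrier w]])
  have Av: "A_mat m *\<^sub>v v \<in> carrier_vec (2 ^ m)"
    by (rule mult_mat_vec_carrier[OF A_mat_carrier v])
  show ?thesis
    unfolding A_mat.simps
    using four_block_mat_mult_vec[OF A_mat_carrier D A_mat_carrier _ v w, of "- D_mat m * A_mat m"]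
      D neg Dw Av assoc_mult_mat_vec[OF D_mat_carrier A_mat_carrier w]
    by (simp add: neg_eq minus_add_uminus_vec[of _ "2 ^ m"])
qed

lemma block_Suc:
  assumes "1 \<le> a"
  shows "block x (Suc L) a = block x L (2 * a - 1) @\<^sub>v block x L (2 * a)"
proof -
  obtain k where "a = Suc k" using assms by (cases a) auto
  then show ?thesis
    by (intro eq_vecI) (auto simp: block_def algebra_simps)
qed

lemma alpha_carrier: "alpha x L a \<in> carrier_vec (2 ^ L)"
  using A_mat_carrier[of L] by (simp add: alpha_def block_def)

lemma alpha_Suc:
  assumes "1 \<le> a"
  shows "alpha x (Suc L) a =
    (alpha x L (2 * a - 1) + D_mat L *\<^sub>v alpha x L (2 * a)) @\<^sub>v
    (alpha x L (2 * a - 1) - D_mat L *\<^sub>v alpha x L (2 * a))"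
proof -
  have "map_vec real_of_int (block x (Suc L) a)
     = map_vec real_of_int (block x L (2 * a - 1)) @\<^sub>v map_vec real_of_int (block x L (2 * a))"
    unfolding block_Suc[OF assms] by (rule eq_vecI) auto
  then show ?thesis
    unfolding alpha_def
    by (simp add: A_mat_Suc_mult_append block_def del: A_mat.simps)
qed

lemma beta_gamma_carrier:
  assumes "b \<in> carrier_vec (2 ^ n)" "c \<in> carrier_vec (2 ^ n)" "L \<le> n"
  shows "beta n b c x L a \<in> carrier_vec (2 ^ L)" "gamma n b c x L a \<in> carrier_vec (2 ^ L)"
proof -
  have D: "D_inv L *\<^sub>v w \<in> carrier_vec (2 ^ L)" for w
    using D_inv(1)[of L] by (intro carrier_vecI) simp
  have rho: "rho L u \<in> carrier_vec (2 ^ L)" for u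
    by (intro carrier_vecI) (simp add: rho_def)
  have top: "L = n" if "n \<le> L"
    using that assms(3) by simp
  show "beta n b c x L a \<in> carrier_vec (2 ^ L)"
    unfolding beta.simps[of n b c x L a] phi_def Let_def using D rho top assms(1) by auto
  show "gamma n b c x L a \<in> carrier_vec (2 ^ L)"
    unfolding gamma.simps[of n b c x L a] psi_def Let_def using D rho top assms(2) by auto
qed

text \<open>For a single coordinate write \<open>d > 0\<close> for the diagonal entry of \<open>D\<^sub>m\<close>. The left-hand side
  is \<open>u\<^sub>1 - p \<le> d q \<le> v\<^sub>1 - p\<close> together with \<open>p - v\<^sub>2 \<le> d q \<le> p - u\<^sub>2\<close>, that is, the bounds
  \<open>\<phi>\<close> and \<open>\<psi>\<close> on \<open>q\<close>. Eliminating \<open>q\<close> gives \<open>u\<^sub>1 - p \<le> p - u\<^sub>2\<close> and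
  \<open>p - v\<^sub>2 \<le> v\<^sub>1 - p\<close>, which are the bounds \<open>\<rho>\<close> on \<open>p\<close>: they bound the first half before the
  second is known.\<close>

lemma append_bounds_iff_halved_bounds:
  assumes p: "p \<in> carrier_vec (2 ^ m)" and q: "q \<in> carrier_vec (2 ^ m)"
    and u: "u \<in> carrier_vec (2 ^ Suc m)" and v: "v \<in> carrier_vec (2 ^ Suc m)"
  shows "(u \<le> (p + D_mat m *\<^sub>v q) @\<^sub>v (p - D_mat m *\<^sub>v q) \<and>
          (p + D_mat m *\<^sub>v q) @\<^sub>v (p - D_mat m *\<^sub>v q) \<le> v)
    \<longleftrightarrow> (rho m u \<le> p \<and> p \<le> rho m v) \<and> (phi m p u v \<le> q \<and> q \<le> psi m p u v)"
  (is "?L \<longleftrightarrow> ?R")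
proof -
  define N where "N = (2::nat) ^ m"
  define r where "r = D_mat m *\<^sub>v q"
  define d where "d i = xi (m + 1) (i + 1)" for i
  have r: "r \<in> carrier_vec N" "\<And>i. i < N \<Longrightarrow> r $ i = d i * q $ i"
    using D_mat_mult_vec_index[OF q] D_mat_carrier[of m] q by (auto simp: r_def N_def d_def)
  have d: "0 < d i" if "i < N" for i
    using xi_pos[of "i + 1" m] that by (simp add: d_def N_def)
  have dims: "dim_vec p = N" "dim_vec q = N" "dim_vec r = N" "dim_vec u = N + N" "dim_vec v = N + N"
    using assms r by (auto simp: N_def)
  have halves: "vec_first u N $ i = u $ i" "vec_first v N $ i = v $ i"
    "vec_last u N $ i = u $ (N + i)" "vec_last v N $ i = v $ (N + i)" if "i < N" for i
    using that dims by (auto simp: vec_first_def vec_last_def)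
  have split: "(\<forall>i<N + N. P i) \<longleftrightarrow> (\<forall>i<N. P i \<and> P (N + i))" for P
    by (metis add.commute add_less_cancel_right le_add_diff_inverse less_diff_conv2 linorder_not_le trans_less_add1)
  have L: "?L \<longleftrightarrow> (\<forall>i<N. (u $ i \<le> p $ i + r $ i \<and> u $ (N + i) \<le> p $ i - r $ i)
      \<and> (p $ i + r $ i \<le> v $ i \<and> p $ i - r $ i \<le> v $ (N + i)))"
    unfolding r_def[symmetric] less_eq_vec_def using dims by (auto simp: split)
  have phi: "phi m p u v $ i = max (u $ i - p $ i) (- v $ (N + i) + p $ i) / d i"
    and psi: "psi m p u v $ i = min (v $ i - p $ i) (- u $ (N + i) + p $ i) / d i" if "i < N" for i
    unfolding phi_def psi_def d_def
    by (subst D_inv_mult_vec_index;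
        use that dims halves[OF that] in \<open>simp add: max_vec_def min_vec_def N_def\<close>)+
  have rho: "rho m u $ i = (u $ i + u $ (N + i)) / 2"
    "rho m v $ i = (v $ i + v $ (N + i)) / 2" if "i < N" for i
    using that halves[OF that] by (simp_all add: rho_def N_def)
  have dim': "dim_vec (rho m w) = N" "dim_vec (phi m p u v) = N" "dim_vec (psi m p u v) = N" for w
    using D_inv(1)[of m] by (auto simp: rho_def phi_def psi_def N_def)
  have R: "?R \<longleftrightarrow> (\<forall>i<N. (rho m u $ i \<le> p $ i \<and> p $ i \<le> rho m v $ i)
      \<and> phi m p u v $ i \<le> q $ i \<and> q $ i \<le> psi m p u v $ i)"
    unfolding less_eq_vec_def using dims dim' by auto
  have "((u $ i \<le> p $ i + r $ i \<and> u $ (N + i) \<le> p $ i - r $ i)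
      \<and> (p $ i + r $ i \<le> v $ i \<and> p $ i - r $ i \<le> v $ (N + i)))
    \<longleftrightarrow> (rho m u $ i \<le> p $ i \<and> p $ i \<le> rho m v $ i)
      \<and> phi m p u v $ i \<le> q $ i \<and> q $ i \<le> psi m p u v $ i" if i: "i < N" for i
    unfolding phi[OF i] psi[OF i] rho[OF i]
    using d[OF i] r(2)[OF i]
    by (simp add: pos_divide_le_eq pos_le_divide_eq mult.commute[of "q $ i"]) linarith
  then show ?thesis
    unfolding L R by blast
qed

lemma block_top:
  assumes "x \<in> carrier_vec (2 ^ n)"
  shows "block x n 1 = x"
  using assms by (intro eq_vecI) (auto simp: block_def)

lemma alpha_0: "alpha x 0 i = vec 1 (\<lambda>_. real_of_int (x $ (i - 1)))"
  by (rule eq_vecI) (auto simp: alpha_def block_def)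

lemma ball_pairs:
  "(\<forall>a \<in> {1..2 * k}. P a) \<longleftrightarrow> (\<forall>a \<in> {1..k::nat}. P (2 * a - 1) \<and> P (2 * a))"
proof (intro iffI ballI)
  fix a assume R: "\<forall>a \<in> {1..k}. P (2 * a - 1) \<and> P (2 * a)" and a: "a \<in> {1..2 * k}"
  have "(a + 1) div 2 \<in> {1..k}" "a = 2 * ((a + 1) div 2) - 1 \<or> a = 2 * ((a + 1) div 2)"
    using a by auto
  then show "P a" using R by metis
next
  fix a assume "\<forall>a \<in> {1..2 * k}. P a" "a \<in> {1..k}"
  moreover from this have "2 * a - 1 \<in> {1..2 * k}" "2 * a \<in> {1..2 * k}" by auto
  ultimately show "P (2 * a - 1) \<and> P (2 * a)" by blast
qed

text \<open>Downward induction on the level: the bounds on the blocks of level \<open>L + 1\<close> are traded, block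
  by block, for the bounds on their halves, so that all intermediate systems are equivalent.\<close>

lemma bounds_iff_block_bounds:
  assumes bc: "b \<in> carrier_vec (2 ^ n)" "c \<in> carrier_vec (2 ^ n)"
    and x: "x \<in> carrier_vec (2 ^ n)" and "L \<le> n"
  shows "(b \<le> A_mat n *\<^sub>v map_vec real_of_int x \<and> A_mat n *\<^sub>v map_vec real_of_int x \<le> c)
    \<longleftrightarrow> (\<forall>a \<in> {1..2 ^ (n - L)}. beta n b c x L a \<le> alpha x L a \<and> alpha x L a \<le> gamma n b c x L a)"
  using \<open>L \<le> n\<close>
proof (induction rule: inc_induct)
  case base
  then show ?case
    using beta_gamma_top[of n b c x] block_top[OF x] by (simp add: alpha_def)
next
  case (step L)
  have halve: "(beta n b c x (Suc L) a \<le> alpha x (Suc L) a \<and> alpha x (Suc L) a \<le> gamma n b c x (Suc L) a)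
    \<longleftrightarrow> (beta n b c x L (2 * a - 1) \<le> alpha x L (2 * a - 1)
        \<and> alpha x L (2 * a - 1) \<le> gamma n b c x L (2 * a - 1))
      \<and> (beta n b c x L (2 * a) \<le> alpha x L (2 * a) \<and> alpha x L (2 * a) \<le> gamma n b c x L (2 * a))"
    if "a \<in> {1..2 ^ (n - Suc L)}" for a
    using that step.hyps beta_gamma_step[of "Suc L" n a b c x]
      append_bounds_iff_halved_bounds[OF alpha_carrier alpha_carrier
        beta_gamma_carrier(1)[OF bc] beta_gamma_carrier(2)[OF bc]]
    by (simp add: alpha_Suc)
  have "(2::nat) ^ (n - L) = 2 * 2 ^ (n - Suc L)"
    using step.hyps by (simp flip: power_Suc add: Suc_diff_Suc)
  then show ?case
    unfolding step.IH by (simp only: ball_pairs halve cong: ball_cong)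
qed

lemma alpha_cong:
  assumes "1 \<le> a" "\<And>j. j < a * 2 ^ L \<Longrightarrow> x $ j = x' $ j"
  shows "alpha x L a = alpha x' L a"
proof -
  obtain k where k: "a = Suc k" using assms(1) by (cases a) auto
  have "block x L a = block x' L a"
    unfolding block_def by (rule eq_vecI) (use assms(2) k in auto)
  then show ?thesis by (simp add: alpha_def)
qed

text \<open>The agreement is required only strictly before block \<open>a\<close>. This hypothesis is inherited by
  the parent block, which starts no later, and if \<open>a\<close> is a second half, it covers its
  sibling, which is where \<open>\<phi>\<close> and \<open>\<psi>\<close> read the entries of \<open>x\<close>.\<close>

lemma beta_gamma_cong:
  assumes "L \<le> n" "1 \<le> a" "\<And>j. j < (a - 1) * 2 ^ L \<Longrightarrow> x $ j = x' $ j"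
  shows "beta n b c x L a = beta n b c x' L a \<and> gamma n b c x L a = gamma n b c x' L a"
  using assms
proof (induction arbitrary: a rule: inc_induct)
  case base
  then show ?case by (simp add: beta.simps gamma.simps)
next
  case (step L)
  define k where "k = (a + 1) div 2"
  have k: "1 \<le> k" "a = 2 * k - 1 \<or> a = 2 * k"
    using step.prems(1) by (auto simp: k_def)
  have "(k - 1) * 2 ^ Suc L = (2 * k - 2) * 2 ^ L"
    by (simp add: diff_mult_distrib)
  also have "\<dots> \<le> (a - 1) * 2 ^ L"
    using k by (intro mult_right_mono) auto
  finally have earlier: "(k - 1) * 2 ^ Suc L \<le> (a - 1) * 2 ^ L" .
  have "x $ j = x' $ j" if "j < (k - 1) * 2 ^ Suc L" for j
    by (rule step.prems(2)) (rule less_le_trans[OF that earlier])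
  then have parent: "beta n b c x (Suc L) k = beta n b c x' (Suc L) k"
    "gamma n b c x (Suc L) k = gamma n b c x' (Suc L) k"
    using step.IH[of k] k(1) by blast+
  have sibling: "alpha x L (2 * k - 1) = alpha x' L (2 * k - 1)" if "a = 2 * k"
    using alpha_cong[of "2 * k - 1" L x x'] step.prems(2) k(1) that by auto
  show ?case
    using k(2) sibling parent step.hyps k(1)
      beta_gamma_step[of "Suc L" n k b c x] beta_gamma_step[of "Suc L" n k b c x']
    by auto
qed

theorem theorem3p9:
  fixes n :: nat and b c :: "real vec"
  assumes "b \<in> carrier_vec (2 ^ n)" and "c \<in> carrier_vec (2 ^ n)"
  shows "(\<forall>x \<in> carrier_vec (2 ^ n).
            (b \<le> A_mat n *\<^sub>v map_vec real_of_int x \<and> A_mat n *\<^sub>v map_vec real_of_int x \<le> c)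
            \<longleftrightarrow> (\<forall>i \<in> {1..2 ^ n}. beta n b c x 0 i $ 0 \<le> real_of_int (x $ (i - 1))
                              \<and> real_of_int (x $ (i - 1)) \<le> gamma n b c x 0 i $ 0))
       \<and> (\<forall>x \<in> carrier_vec (2 ^ n). \<forall>x' \<in> carrier_vec (2 ^ n).
            beta n b c x 0 1 = beta n b c x' 0 1 \<and> gamma n b c x 0 1 = gamma n b c x' 0 1)
       \<and> (\<forall>i \<in> {2..2 ^ n}. \<forall>x \<in> carrier_vec (2 ^ n). \<forall>x' \<in> carrier_vec (2 ^ n).
            (\<forall>j \<in> {1..i - 1}. x $ (j - 1) = x' $ (j - 1))
            \<longrightarrow> beta n b c x 0 i = beta n b c x' 0 i \<and> gamma n b c x 0 i = gamma n b c x' 0 i)"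
proof (intro conjI[OF _ conjI] ballI impI)
  fix x :: "int vec" assume x: "x \<in> carrier_vec (2 ^ n)"
  have "dim_vec (beta n b c x 0 i) = 1" "dim_vec (gamma n b c x 0 i) = 1" for i
    using beta_gamma_carrier[OF assms, of 0 x i] by auto
  then show "(b \<le> A_mat n *\<^sub>v map_vec real_of_int x \<and> A_mat n *\<^sub>v map_vec real_of_int x \<le> c)
    \<longleftrightarrow> (\<forall>i \<in> {1..2 ^ n}. beta n b c x 0 i $ 0 \<le> real_of_int (x $ (i - 1))
                      \<and> real_of_int (x $ (i - 1)) \<le> gamma n b c x 0 i $ 0)"
    using bounds_iff_block_bounds[OF assms x, of 0] by (simp add: alpha_0 less_eq_vec_def)
next
  fix x x' :: "int vec"
  show "beta n b c x 0 1 = beta n b c x' 0 1 \<and> gamma n b c x 0 1 = gamma n b c x' 0 1"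
    by (rule beta_gamma_cong) auto
next
  fix i and x x' :: "int vec"
  assume i: "i \<in> {2..2 ^ n}" and eq: "\<forall>j \<in> {1..i - 1}. x $ (j - 1) = x' $ (j - 1)"
  have "x $ j = x' $ j" if "j < i - 1" for j
    using bspec[OF eq, of "Suc j"] that by auto
  then show "beta n b c x 0 i = beta n b c x' 0 i \<and> gamma n b c x 0 i = gamma n b c x' 0 i"
    using i by (intro beta_gamma_cong) auto
qed

end
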